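(* The six-element ai-semirings $\mathcal B_2^1$ and $\mathcal A_2^1$ are inherently nonfinitely based.
   Context: An ai-semiring is an algebra $(S,+,\cdot)$ with two binary operations and no designated constants, such that $(S,+)$ is a commutative idempotent semigroup, $(S,\cdot)$ is a semigroup, and $\cdot$ distributes over $+$ on both sides. Its additive order is $x\le y\iff x+y=y$, so $+$ is the join for this order. $\mathcal B_2^1=\{0,1,c,d,cd,dc\}$: the multiplication is that of the monoid with zero $\langle c,d,1,0\mid cdc=c,\ dcd=d,\ c^2=d^2=0\rangle$. Its additive order has greatest element $0$; the elements $c,d,cd,dc$ are pairwise incomparable and lie below $0$; $1$ lies below $cd$, $dc$ (hence below $0$) and is incomparable with $c$ and $d$. Thus $1+cd=cd$, $1+dc=dc$, and all other sums of two distinct elements are $0$. $\mathcal A_2^1=\{0,1,a,b,ab,ba\}$: the multiplication is that of the monoid with zero $\langle a,b,1,0\mid a^2=a,\ b^2=0,\ aba=a,\ bab=b\rangle$. Its additive order is $a<1<ab,ba<b<0$ with $ab,ba$ incomparable (so $ab+ba=b$), and addition is the join. Varieties are in the signature $\{+,\cdot\}$. A variety is locally finite if all finitely generated members are finite, and finitely based if it is axiomatized by finitely many identities. A locally finite variety is inherently nonfinitely based if it is contained in no finitely based locally finite variety of the same signature; an algebra is inherently nonfinitely based if the variety it generates is. *)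

theory Defs
  imports Main
begin

section \<open>Algebras and identities in the signature with two binary operations\<close>

record 'a alg =
  carr :: "'a set"
  add_op :: "'a \<Rightarrow> 'a \<Rightarrow> 'a"
  mul_op :: "'a \<Rightarrow> 'a \<Rightarrow> 'a"

definition algebra :: "'a alg \<Rightarrow> bool" where
  "algebra A \<longleftrightarrow> carr A \<noteq> {} \<and>
     (\<forall>x\<in>carr A. \<forall>y\<in>carr A. add_op A x y \<in> carr A \<and> mul_op A x y \<in> carr A)"

definition ai_semiring :: "'a alg \<Rightarrow> bool" where
  "ai_semiring A \<longleftrightarrow> algebra A \<and>
     (\<forall>x\<in>carr A. \<forall>y\<in>carr A. \<forall>z\<in>carr A.
        add_op A (add_op A x y) z = add_op A x (add_op A y z) \<and>
        add_op A x y = add_op A y x \<and>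
        add_op A x x = x \<and>
        mul_op A (mul_op A x y) z = mul_op A x (mul_op A y z) \<and>
        mul_op A x (add_op A y z) = add_op A (mul_op A x y) (mul_op A x z) \<and>
        mul_op A (add_op A x y) z = add_op A (mul_op A x z) (mul_op A y z))"

datatype trm = Var nat | Add trm trm | Mul trm trm

type_synonym identity = "trm \<times> trm"

primrec eval_trm :: "'a alg \<Rightarrow> (nat \<Rightarrow> 'a) \<Rightarrow> trm \<Rightarrow> 'a" where
  "eval_trm A v (Var n) = v n"
| "eval_trm A v (Add s t) = add_op A (eval_trm A v s) (eval_trm A v t)"
| "eval_trm A v (Mul s t) = mul_op A (eval_trm A v s) (eval_trm A v t)"

definition satisfies :: "'a alg \<Rightarrow> identity set \<Rightarrow> bool" where
  "satisfies A E \<longleftrightarrow>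
     (\<forall>(s, t)\<in>E. \<forall>v. range v \<subseteq> carr A \<longrightarrow> eval_trm A v s = eval_trm A v t)"

inductive_set generated :: "'a alg \<Rightarrow> 'a set \<Rightarrow> 'a set" for A X where
  gen_base: "x \<in> X \<Longrightarrow> x \<in> generated A X"
| gen_add: "x \<in> generated A X \<Longrightarrow> y \<in> generated A X \<Longrightarrow> add_op A x y \<in> generated A X"
| gen_mul: "x \<in> generated A X \<Longrightarrow> y \<in> generated A X \<Longrightarrow> mul_op A x y \<in> generated A X"

definition finitely_generated :: "'a alg \<Rightarrow> bool" where
  "finitely_generated A \<longleftrightarrow> (\<exists>X. finite X \<and> X \<subseteq> carr A \<and> generated A X = carr A)"


section \<open>Varieties\<close>

text \<open>
  A variety is the class of all algebras satisfying some set of identities. Classes of algebras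
  are sets of algebras whose carriers are subsets of a type \<open>'u\<close>, which is
  meant to be infinite: then \<open>'u\<close> carries a copy of every countable algebra, in particular of every
  finitely generated algebra and of all relatively free algebras on countably many generators.
  Hence inclusion, finite axiomatizability and local finiteness of the classes over
  \<open>'u\<close> coincide with those of the corresponding unrestricted varieties.
\<close>

definition models :: "identity set \<Rightarrow> 'u alg set" where
  "models E = {A. algebra A \<and> satisfies A E}"

definition variety :: "'u alg set \<Rightarrow> bool" where
  "variety V \<longleftrightarrow> (\<exists>E. V = models E)"

definition finitely_based :: "'u alg set \<Rightarrow> bool" where
  "finitely_based V \<longleftrightarrow> (\<exists>E. finite E \<and> V = models E)"

definition locally_finite :: "'u alg set \<Rightarrow> bool" where
  "locally_finite V \<longleftrightarrow> (\<forall>A\<in>V. finitely_generated A \<longrightarrow> finite (carr A))"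

definition inherently_nonfinitely_based :: "'u alg set \<Rightarrow> bool" where
  "inherently_nonfinitely_based V \<longleftrightarrow>
     variety V \<and> locally_finite V \<and>
     \<not> (\<exists>W. variety W \<and> finitely_based W \<and> locally_finite W \<and> V \<subseteq> W)"

text \<open>
  The least variety containing \<open>A\<close>. As the carrier of \<open>A\<close> may live in a type other than
  \<open>'u\<close>, that the variety axiomatized by \<open>E\<close> contains \<open>A\<close> is expressed by
  \<open>A\<close> satisfying \<open>E\<close>.
\<close>

definition variety_generated_by :: "'a alg \<Rightarrow> 'u alg set" where
  "variety_generated_by A = \<Inter> {models E | E. satisfies A E}"

definition inherently_nonfinitely_based_algebra :: "'u itself \<Rightarrow> 'a alg \<Rightarrow> bool" where
  "inherently_nonfinitely_based_algebra _ A \<longleftrightarrow>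
     inherently_nonfinitely_based (variety_generated_by A :: 'u alg set)"

lemma variety_variety_generated_by: "variety (variety_generated_by A)"
proof -
  have "variety_generated_by A = models (\<Union> {E. satisfies A E})"
    by (auto simp: variety_generated_by_def models_def satisfies_def) blast+
  then show ?thesis by (auto simp: variety_def)
qed


section \<open>The ai-semiring \<open>B21\<close>\<close>

datatype B21_elem = B0 | B1 | Bc | Bd | Bcd | Bdc

fun B21_mul :: "B21_elem \<Rightarrow> B21_elem \<Rightarrow> B21_elem" where
  "B21_mul B1 y = y"
| "B21_mul x B1 = x"
| "B21_mul Bc Bd = Bcd"
| "B21_mul Bc Bdc = Bc"
| "B21_mul Bd Bc = Bdc"
| "B21_mul Bd Bcd = Bd"
| "B21_mul Bcd Bc = Bc"
| "B21_mul Bcd Bcd = Bcd"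
| "B21_mul Bdc Bd = Bd"
| "B21_mul Bdc Bdc = Bdc"
| "B21_mul _ _ = B0"

definition B21_add :: "B21_elem \<Rightarrow> B21_elem \<Rightarrow> B21_elem" where
  "B21_add x y =
     (if x = y then x
      else if {x, y} = {B1, Bcd} then Bcd
      else if {x, y} = {B1, Bdc} then Bdc
      else B0)"

definition B21 :: "B21_elem alg" where
  "B21 = \<lparr>carr = UNIV, add_op = B21_add, mul_op = B21_mul\<rparr>"

lemma all_B21_elem: "(\<forall>x. P x) \<longleftrightarrow> P B0 \<and> P B1 \<and> P Bc \<and> P Bd \<and> P Bcd \<and> P Bdc"
  by (metis B21_elem.exhaust)

lemma ai_semiring_B21: "ai_semiring B21"
  unfolding ai_semiring_def algebra_def B21_def
  by (simp add: all_B21_elem B21_add_def doubleton_eq_iff)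

text \<open>The multiplication is that of the monoid with zero presented by
  \<open>cdc = c, dcd = d, c\<^sup>2 = d\<^sup>2 = 0\<close>.\<close>

lemma B21_relations:
  "B21_mul Bc Bd = Bcd" "B21_mul Bd Bc = Bdc"
  "B21_mul (B21_mul Bc Bd) Bc = Bc" "B21_mul (B21_mul Bd Bc) Bd = Bd"
  "B21_mul Bc Bc = B0" "B21_mul Bd Bd = B0"
  "B21_mul B1 x = x" "B21_mul x B1 = x" "B21_mul B0 x = B0" "B21_mul x B0 = B0"
  by (cases x; simp)+

lemma B21_presentation:
  fixes c d :: "'m :: {monoid_mult, mult_zero}"
  assumes "c * d * c = c" "d * c * d = d" "c * c = 0" "d * d = 0"
  shows "\<exists>!h. h B0 = 0 \<and> h B1 = 1 \<and> h Bc = c \<and> h Bd = d \<and>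
           (\<forall>x y. h (B21_mul x y) = h x * h y)"
proof -
  let ?h = "\<lambda>x. case x of B0 \<Rightarrow> 0 | B1 \<Rightarrow> 1 | Bc \<Rightarrow> c | Bd \<Rightarrow> d | Bcd \<Rightarrow> c * d | Bdc \<Rightarrow> d * c"
  have l: "c * (c * z) = 0" "d * (d * z) = 0" "c * (d * (c * z)) = c * z"
    "d * (c * (d * z)) = d * z" for z
    by (simp_all add: assms mult.assoc[symmetric])
  have r: "c * (d * c) = c" "d * (c * d) = d"
    using assms by (simp_all add: mult.assoc)
  show ?thesis
  proof (rule ex1I[of _ ?h])
    show "?h B0 = 0 \<and> ?h B1 = 1 \<and> ?h Bc = c \<and> ?h Bd = d \<and>
        (\<forall>x y. ?h (B21_mul x y) = ?h x * ?h y)"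
      by (simp add: all_B21_elem mult.assoc assms l r)
  next
    fix h assume h: "h B0 = 0 \<and> h B1 = 1 \<and> h Bc = c \<and> h Bd = d \<and>
        (\<forall>x y. h (B21_mul x y) = h x * h y)"
    then have "h Bcd = c * d" "h Bdc = d * c"
      by (metis B21_relations(1), metis B21_relations(2))
    with h show "h = ?h" by (auto simp: fun_eq_iff split: B21_elem.split)
  qed
qed


section \<open>The ai-semiring \<open>A21\<close>\<close>

datatype A21_elem = A0 | A1 | Aa | Ab | Aab | Aba

fun A21_mul :: "A21_elem \<Rightarrow> A21_elem \<Rightarrow> A21_elem" where
  "A21_mul A1 y = y"
| "A21_mul x A1 = x"
| "A21_mul Aa Aa = Aa"
| "A21_mul Aa Ab = Aab"
| "A21_mul Aa Aab = Aab"
| "A21_mul Aa Aba = Aa"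
| "A21_mul Ab Aa = Aba"
| "A21_mul Ab Aab = Ab"
| "A21_mul Aab Aa = Aa"
| "A21_mul Aab Aab = Aab"
| "A21_mul Aba Aa = Aba"
| "A21_mul Aba Ab = Ab"
| "A21_mul Aba Aab = Ab"
| "A21_mul Aba Aba = Aba"
| "A21_mul _ _ = A0"

text \<open>The additive order is \<open>a < 1 < ab, ba < b < 0\<close>; the height function below determines it,
  \<open>ab\<close> and \<open>ba\<close> being the only distinct elements of equal height.\<close>

fun A21_height :: "A21_elem \<Rightarrow> nat" where
  "A21_height Aa = 0"
| "A21_height A1 = 1"
| "A21_height Aab = 2"
| "A21_height Aba = 2"
| "A21_height Ab = 3"
| "A21_height A0 = 4"

definition A21_add :: "A21_elem \<Rightarrow> A21_elem \<Rightarrow> A21_elem" where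
  "A21_add x y =
     (if x = y then x
      else if A21_height x < A21_height y then y
      else if A21_height y < A21_height x then x
      else Ab)"

definition A21 :: "A21_elem alg" where
  "A21 = \<lparr>carr = UNIV, add_op = A21_add, mul_op = A21_mul\<rparr>"

lemma all_A21_elem: "(\<forall>x. P x) \<longleftrightarrow> P A0 \<and> P A1 \<and> P Aa \<and> P Ab \<and> P Aab \<and> P Aba"
  by (metis A21_elem.exhaust)

lemma ai_semiring_A21: "ai_semiring A21"
  unfolding ai_semiring_def algebra_def A21_def
  by (simp add: all_A21_elem A21_add_def)

text \<open>The multiplication is that of the monoid with zero presented by
  \<open>a\<^sup>2 = a, b\<^sup>2 = 0, aba = a, bab = b\<close>.\<close>

lemma A21_relations:
  "A21_mul Aa Ab = Aab" "A21_mul Ab Aa = Aba"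
  "A21_mul Aa Aa = Aa" "A21_mul Ab Ab = A0"
  "A21_mul (A21_mul Aa Ab) Aa = Aa" "A21_mul (A21_mul Ab Aa) Ab = Ab"
  "A21_mul A1 x = x" "A21_mul x A1 = x" "A21_mul A0 x = A0" "A21_mul x A0 = A0"
  by (cases x; simp)+

lemma A21_presentation:
  fixes a b :: "'m :: {monoid_mult, mult_zero}"
  assumes "a * a = a" "b * b = 0" "a * b * a = a" "b * a * b = b"
  shows "\<exists>!h. h A0 = 0 \<and> h A1 = 1 \<and> h Aa = a \<and> h Ab = b \<and>
           (\<forall>x y. h (A21_mul x y) = h x * h y)"
proof -
  let ?h = "\<lambda>x. case x of A0 \<Rightarrow> 0 | A1 \<Rightarrow> 1 | Aa \<Rightarrow> a | Ab \<Rightarrow> b | Aab \<Rightarrow> a * b | Aba \<Rightarrow> b * a"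
  have l: "a * (a * z) = a * z" "b * (b * z) = 0" "a * (b * (a * z)) = a * z"
    "b * (a * (b * z)) = b * z" for z
    by (simp_all add: assms mult.assoc[symmetric])
  have r: "a * (b * a) = a" "b * (a * b) = b"
    using assms by (simp_all add: mult.assoc)
  show ?thesis
  proof (rule ex1I[of _ ?h])
    show "?h A0 = 0 \<and> ?h A1 = 1 \<and> ?h Aa = a \<and> ?h Ab = b \<and>
        (\<forall>x y. ?h (A21_mul x y) = ?h x * ?h y)"
      by (simp add: all_A21_elem mult.assoc assms l r)
  next
    fix h assume h: "h A0 = 0 \<and> h A1 = 1 \<and> h Aa = a \<and> h Ab = b \<and>
        (\<forall>x y. h (A21_mul x y) = h x * h y)"
    then have "h Aab = a * b" "h Aba = b * a"
      by (metis A21_relations(1), metis A21_relations(2))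
    with h show "h = ?h" by (auto simp: fun_eq_iff split: A21_elem.split)
  qed
qed

end

(* Let W be a variety containing A (B21 or A21), axiomatized by identities in n variables. An
   identity of A with a single value on one side amounts to inequalities u <= w_1 + ... + w_k, and
   evaluating letters by 1 and by matrix units shows: if the letters not sent to 1 carry end
   vertices and all w_i spell paths from a to b, then so does u. Consider the flat algebra of
   factors of an infinite word that is the fixed point of a substitution with blocks of length
   2(n+1). If n words f(x) are substituted into w_1, ..., w_k, all giving the same factor, then
   some pair of adjacent columns is never cut; it determines the blocks, so desubstitution and
   induction on the length show that u has the right sequence of blocks, and the path property
   applied to that pair together with one further column at a time shows that f(u) is the same
   factor. Hence this infinite, finitely generated algebra lies in W. *)

theory Submission
  imports Defs "HOL-Library.Countable" "HOL-Library.FuncSet" "HOL-Library.Infinite_Set"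
begin

section \<open>Local finiteness and copies of algebras\<close>

primrec vars :: "trm \<Rightarrow> nat set" where
  "vars (Var n) = {n}"
| "vars (Add s t) = vars s \<union> vars t"
| "vars (Mul s t) = vars s \<union> vars t"

lemma finite_vars: "finite (vars t)"
  by (induction t) auto

lemma eval_trm_cong: "(\<And>x. x \<in> vars t \<Longrightarrow> v x = v' x) \<Longrightarrow> eval_trm A v t = eval_trm A v' t"
  by (induction t) auto

lemma eval_trm_in_carr:
  "algebra A \<Longrightarrow> range v \<subseteq> carr A \<Longrightarrow> eval_trm A v t \<in> carr A"
  by (induction t) (auto simp: algebra_def)

lemma generated_eval_trm:
  assumes "x \<in> generated A (v ` I)"
  shows "\<exists>t. vars t \<subseteq> I \<and> eval_trm A v t = x"
  using assms
proof induction
  case (gen_base x)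
  then obtain i where "i \<in> I" "x = v i" by auto
  then show ?case by (intro exI[of _ "Var i"]) auto
next
  case (gen_add x y)
  then obtain s t where "vars s \<subseteq> I" "eval_trm A v s = x" "vars t \<subseteq> I" "eval_trm A v t = y" by auto
  then show ?case by (intro exI[of _ "Add s t"]) auto
next
  case (gen_mul x y)
  then obtain s t where "vars s \<subseteq> I" "eval_trm A v s = x" "vars t \<subseteq> I" "eval_trm A v t = y" by auto
  then show ?case by (intro exI[of _ "Mul s t"]) auto
qed

lemma satisfies_swap: "satisfies A {(s, t)} \<Longrightarrow> satisfies A {(t, s)}"
  by (auto simp: satisfies_def)

lemma satisfies_subset: "satisfies A E \<Longrightarrow> F \<subseteq> E \<Longrightarrow> satisfies A F"
  unfolding satisfies_def by blast

text \<open>Terms in \<open>k\<close> variables with the same term function on \<open>A\<close> form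
  an identity of \<open>A\<close>, so they agree in \<open>C\<close>; over a finite \<open>A\<close>
  there are finitely many such functions.\<close>

lemma locally_finite_variety_generated_by:
  fixes A :: "'a alg"
  assumes A: "algebra A" and fin: "finite (carr A)"
  shows "locally_finite (variety_generated_by A :: 'u alg set)"
  unfolding locally_finite_def
proof (intro ballI impI)
  fix C :: "'u alg"
  assume C: "C \<in> variety_generated_by A" and fg: "finitely_generated C"
  have sat: "satisfies C E" and alg: "algebra C" if "satisfies A E" for E
    using C that by (auto simp: variety_generated_by_def models_def)
  have alg: "algebra C" using alg[of "{}"] by (simp add: satisfies_def)
  then obtain z where z: "z \<in> carr C" by (auto simp: algebra_def)
  obtain X where X: "finite X" "X \<subseteq> carr C" "generated C X = carr C"
    using fg by (auto simp: finitely_generated_def)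
  obtain h :: "nat \<Rightarrow> 'u" and k where h: "X = h ` {i. i < k}"
    using finite_imp_nat_seg_image_inj_on[OF X(1)] by blast
  define v where "v i = (if i < k then h i else z)" for i
  have v: "X = v ` {..<k}" "range v \<subseteq> carr C"
    using h X(2) z by (auto simp: v_def image_def)
  define T where "T = {t. vars t \<subseteq> {..<k}}"
  \<comment> \<open>Entry \<open>k\<close> serves all variables from \<open>k\<close> on, so a
    function on a finite set gives a total valuation.\<close>
  define D where "D = PiE {..k} (\<lambda>_. carr A)"
  define F where "F t = restrict (\<lambda>w. eval_trm A (\<lambda>i. w (min i k)) t) D" for t
  have key: "eval_trm C v s = eval_trm C v t" if "s \<in> T" "t \<in> T" "F s = F t" for s t
  proof -
    have "satisfies A {(s, t)}"
      unfolding satisfies_def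
    proof clarify
      fix w :: "nat \<Rightarrow> 'a" assume w: "range w \<subseteq> carr A"
      define w' where "w' = restrict w {..k}"
      have "w' \<in> D" using w by (simp add: w'_def D_def restrict_PiE_iff image_subset_iff)
      moreover have "F s w' = F t w'" using that by simp
      ultimately have "eval_trm A (\<lambda>i. w' (min i k)) s = eval_trm A (\<lambda>i. w' (min i k)) t"
        by (simp add: F_def)
      moreover have "eval_trm A (\<lambda>i. w' (min i k)) p = eval_trm A w p" if "p \<in> T" for p
        using that by (intro eval_trm_cong) (auto simp: T_def w'_def min_def)
      ultimately show "eval_trm A w s = eval_trm A w t" using \<open>s \<in> T\<close> \<open>t \<in> T\<close> by simp
    qed
    from sat[OF this] v(2) show ?thesis by (simp add: satisfies_def)
  qed
  have "eval_trm A (\<lambda>i. w (min i k)) t \<in> carr A" if "w \<in> D" for w t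
    using that by (intro eval_trm_in_carr[OF A]) (auto simp: D_def PiE_iff)
  then have "F ` T \<subseteq> PiE D (\<lambda>_. carr A)"
    by (intro image_subsetI) (simp add: F_def restrict_PiE_iff)
  then have "finite (F ` T)"
    by (rule finite_subset) (simp add: D_def finite_PiE fin)
  moreover have "carr C \<subseteq> (\<lambda>p. eval_trm C v (inv_into T F p)) ` (F ` T)"
  proof
    fix x assume "x \<in> carr C"
    then have "x \<in> generated C (v ` {..<k})" using X(3) v(1) by simp
    from generated_eval_trm[OF this] obtain t where t: "t \<in> T" "eval_trm C v t = x"
      unfolding T_def by blast
    have "F t \<in> F ` T" using t(1) by simp
    then have "eval_trm C v (inv_into T F (F t)) = x"
      using key[OF inv_into_into t(1)] f_inv_into_f t(2) by metis
    then show "x \<in> (\<lambda>p. eval_trm C v (inv_into T F p)) ` (F ` T)"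
      using \<open>F t \<in> F ` T\<close> by (metis image_eqI)
  qed
  ultimately show "finite (carr C)" by (meson finite_imageI finite_subset)
qed

text \<open>Varieties are classes over \<open>'u\<close>, so algebras over other types enter them
  through an injection \<open>g\<close>.\<close>

definition copy :: "('a \<Rightarrow> 'u) \<Rightarrow> 'a alg \<Rightarrow> 'u alg" where
  "copy g A = \<lparr>carr = g ` carr A,
     add_op = \<lambda>x y. g (add_op A (inv g x) (inv g y)),
     mul_op = \<lambda>x y. g (mul_op A (inv g x) (inv g y))\<rparr>"

lemma eval_trm_copy:
  "inj g \<Longrightarrow> eval_trm (copy g A) (\<lambda>x. g (v x)) t = g (eval_trm A v t)"
  by (induction t) (auto simp: copy_def)

lemma algebra_copy: "inj g \<Longrightarrow> algebra A \<Longrightarrow> algebra (copy g A)"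
  by (auto simp: algebra_def copy_def)

lemma satisfies_copy:
  fixes g :: "'a \<Rightarrow> 'b"
  assumes "inj g"
  shows "satisfies (copy g A) E \<longleftrightarrow> satisfies A E"
proof -
  have *: "(\<forall>v. range v \<subseteq> carr (copy g A) \<longrightarrow> Q v) \<longleftrightarrow>
      (\<forall>w. range w \<subseteq> carr A \<longrightarrow> Q (\<lambda>x. g (w x)))" for Q :: "(nat \<Rightarrow> 'b) \<Rightarrow> bool"
  proof (intro iffI allI impI)
    fix v :: "nat \<Rightarrow> 'b"
    assume v: "range v \<subseteq> carr (copy g A)"
      and Q: "\<forall>w. range w \<subseteq> carr A \<longrightarrow> Q (\<lambda>x. g (w x))"
    have "\<exists>y. y \<in> carr A \<and> v x = g y" for x
    proof -
      have "v x \<in> g ` carr A" using v by (auto simp: copy_def)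
      then show ?thesis by blast
    qed
    then obtain w where w: "\<And>x. w x \<in> carr A" "\<And>x. v x = g (w x)" by metis
    then have "v = (\<lambda>x. g (w x))" "range w \<subseteq> carr A" by auto
    then show "Q v" using Q by simp
  next
    fix w :: "nat \<Rightarrow> 'a"
    assume "\<forall>v. range v \<subseteq> carr (copy g A) \<longrightarrow> Q v" and w: "range w \<subseteq> carr A"
    moreover have "range (\<lambda>x. g (w x)) \<subseteq> carr (copy g A)"
      using w by (auto simp: copy_def)
    ultimately show "Q (\<lambda>x. g (w x))" by blast
  qed
  show ?thesis
    unfolding satisfies_def * eval_trm_copy[OF assms] inj_eq[OF assms] ..
qed

lemma generated_copy:
  assumes "inj g" "x \<in> generated A X"
  shows "g x \<in> generated (copy g A) (g ` X)"
  using assms(2)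
proof induction
  case (gen_base x)
  then show ?case by (auto intro: generated.gen_base)
next
  case (gen_add x y)
  from generated.gen_add[OF gen_add.IH] show ?case using assms(1) by (simp add: copy_def)
next
  case (gen_mul x y)
  from generated.gen_mul[OF gen_mul.IH] show ?case using assms(1) by (simp add: copy_def)
qed

lemma generated_subset_carr:
  "algebra A \<Longrightarrow> X \<subseteq> carr A \<Longrightarrow> generated A X \<subseteq> carr A"
  by (rule subsetI, erule generated.induct) (auto simp: algebra_def)

lemma finitely_generated_copy:
  assumes "inj g" "algebra A" "finitely_generated A"
  shows "finitely_generated (copy g A)"
proof -
  obtain X where X: "finite X" "X \<subseteq> carr A" "generated A X = carr A"
    using assms(3) by (auto simp: finitely_generated_def)
  have "g ` X \<subseteq> carr (copy g A)" using X(2) by (auto simp: copy_def)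
  moreover have "carr (copy g A) \<subseteq> generated (copy g A) (g ` X)"
    using generated_copy[OF assms(1)] X(3) by (auto simp: copy_def)
  ultimately show ?thesis
    using X(1) generated_subset_carr[OF algebra_copy[OF assms(1,2)]]
    unfolding finitely_generated_def by (metis finite_imageI subset_antisym)
qed


section \<open>Walks and admissible pairs\<close>

text \<open>Distributing products over sums turns a term into a sum of these words.\<close>

primrec words :: "trm \<Rightarrow> nat list set" where
  "words (Var n) = {[n]}"
| "words (Add s t) = words s \<union> words t"
| "words (Mul s t) = {u @ w |u w. u \<in> words s \<and> w \<in> words t}"

lemma words_nonempty: "words t \<noteq> {}"
  by (induction t) auto

lemma words_vars: "w \<in> words t \<Longrightarrow> set w \<subseteq> vars t"
  by (induction t arbitrary: w) fastforce+

text \<open>\<open>R\<close> compares \<open>a\<close> with the first source, each target with the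
  next source, and the last target with \<open>z\<close>. Products in \<open>B21\<close> test
  equality, those in \<open>A21\<close> implication.\<close>

primrec walk :: "('v \<Rightarrow> 'v \<Rightarrow> bool) \<Rightarrow> ('e \<Rightarrow> 'v) \<Rightarrow> ('e \<Rightarrow> 'v) \<Rightarrow> 'v \<Rightarrow> 'e list \<Rightarrow> 'v \<Rightarrow> bool" where
  "walk R s t a [] z \<longleftrightarrow> R a z"
| "walk R s t a (x # xs) z \<longleftrightarrow> R a (s x) \<and> walk R s t (t x) xs z"

abbreviation path :: "('e \<Rightarrow> 'v) \<Rightarrow> ('e \<Rightarrow> 'v) \<Rightarrow> 'v \<Rightarrow> 'e list \<Rightarrow> 'v \<Rightarrow> bool" where
  "path \<equiv> walk (=)"

lemma path_append: "path s t a (xs @ ys) z \<longleftrightarrow> (\<exists>m. path s t a xs m \<and> path s t m ys z)"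
  by (induction xs arbitrary: a) auto

lemma path_last: "xs \<noteq> [] \<Longrightarrow> path s t a xs z \<Longrightarrow> z = t (last xs)"
proof (induction xs arbitrary: a)
  case (Cons x xs)
  then show ?case by (cases "xs = []") auto
qed simp

lemma path_nonempty:
  assumes "xs \<noteq> []"
  shows "path s t a xs z \<longleftrightarrow>
    a = s (hd xs) \<and> z = t (last xs) \<and> path s t (s (hd xs)) xs (t (last xs))"
  using assms path_last[OF assms, of s t] by (cases xs) auto

lemma path_map: "path s t a xs z \<Longrightarrow> path (\<lambda>x. U (s x)) (\<lambda>x. U (t x)) (U a) xs (U z)"
  by (induction xs arbitrary: a) auto

text \<open>The indicator of a vertex separates it from all others, so the two-valued vertices that
  2 by 2 matrix units can test detect paths over any vertex set.\<close>

lemma path_if_path_bool: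
  assumes "\<And>U :: 'v \<Rightarrow> bool. path (\<lambda>x. U (s x)) (\<lambda>x. U (t x)) (U a) xs (U z)"
  shows "path s t a xs z"
  using assms
proof (induction xs arbitrary: a)
  case Nil
  then show ?case using Nil[of "\<lambda>v. v = a"] by simp
next
  case (Cons x xs)
  then show ?case using Cons.prems[of "\<lambda>v. v = a"] by simp
qed

text \<open>What an inequality \<open>u \<le> \<Sum>P\<close> valid in \<open>B21\<close> or \<open>A21\<close> implies: send the letters outside \<open>K\<close> to \<open>1\<close>
  and the others to the matrix units given by their end vertices.\<close>

definition admissible :: "nat list set \<Rightarrow> nat list \<Rightarrow> bool" where
  "admissible P u \<longleftrightarrow> set u \<subseteq> (\<Union>w\<in>P. set w) \<and>
     (\<forall>K (s :: nat \<Rightarrow> bool) t a z.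
        (\<forall>w\<in>P. path s t a (filter K w) z) \<longrightarrow> path s t a (filter K u) z)"

text \<open>A nonempty image acts as one edge from the source of its first letter to the target of
  its last; empty images vanish.\<close>

lemma path_concat:
  "path s t a (concat (map f w)) z \<longleftrightarrow>
     path (\<lambda>x. s (hd (f x))) (\<lambda>x. t (last (f x))) a (filter (\<lambda>x. f x \<noteq> []) w) z \<and>
     (\<forall>x\<in>set w. f x \<noteq> [] \<longrightarrow> path s t (s (hd (f x))) (f x) (t (last (f x))))"
proof (induction w arbitrary: a)
  case (Cons x w)
  show ?case
  proof (cases "f x = []")
    case True
    then show ?thesis using Cons by simp
  next
    case False
    define Q where "Q = path s t (s (hd (f x))) (f x) (t (last (f x)))"
    have "path s t a (f x) m \<longleftrightarrow> a = s (hd (f x)) \<and> m = t (last (f x)) \<and> Q" for m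
      unfolding Q_def by (rule path_nonempty[OF False])
    then show ?thesis
      using False by (simp add: path_append Cons.IH flip: Q_def) auto
  qed
qed simp

text \<open>Take for \<open>K\<close> the letters with nonempty image and let each act as one edge.
  The paths inside the images come from words of \<open>P\<close>, since every letter of
  \<open>u\<close> occurs there.\<close>

lemma admissible_path:
  assumes adm: "admissible P u"
    and P: "\<And>w. w \<in> P \<Longrightarrow> path s t a (concat (map f w)) z"
  shows "path s t a (concat (map f u)) z"
proof -
  let ?S = "\<lambda>x. s (hd (f x))" and ?T = "\<lambda>x. t (last (f x))"
  let ?K = "\<lambda>x. f x \<noteq> []"
  have content: "set u \<subseteq> (\<Union>w\<in>P. set w)"
    and test: "\<forall>w\<in>P. path S T b (filter K w) c \<Longrightarrow> path S T b (filter K u) c"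
    for K and S T :: "nat \<Rightarrow> bool" and b c
    using adm by (simp_all add: admissible_def)
  have P': "path ?S ?T a (filter ?K w) z"
      "\<forall>x\<in>set w. f x \<noteq> [] \<longrightarrow> path s t (?S x) (f x) (?T x)" if "w \<in> P" for w
    using P[OF that] unfolding path_concat by iprover+
  have "path ?S ?T a (filter ?K u) z"
    by (rule path_if_path_bool, rule test, rule ballI, rule path_map, rule P'(1))
  moreover have "\<forall>x\<in>set u. f x \<noteq> [] \<longrightarrow> path s t (?S x) (f x) (?T x)"
    using content P'(2) by blast
  ultimately show ?thesis unfolding path_concat by iprover
qed


section \<open>An infinite word with rigid factors\<close>

text \<open>The letters \<open>(alpha r N, N mod r)\<close> form the fixed point of the substitution that replaces a letter
  \<open>(i, k)\<close> by the block \<open>(i, 0) (k, 1) (i, 2) (k, 3) \<dots>\<close> of length \<open>r\<close>. So any two adjacent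
  columns of a block determine it.\<close>

fun alpha :: "nat \<Rightarrow> nat \<Rightarrow> nat" where
  "alpha r N = (if r < 2 \<or> N = 0 then 0
     else if even (N mod r) then alpha r (N div r) else (N div r) mod r)"

declare alpha.simps [simp del]

definition letter :: "nat \<Rightarrow> nat \<Rightarrow> nat \<times> nat" where
  "letter r N = (alpha r N, N mod r)"

text \<open>Position \<open>q * r + j\<close> is column \<open>j\<close> of the block that replaces
  the letter at position \<open>q\<close>.\<close>

lemma alpha_block:
  assumes "2 \<le> r" "j < r"
  shows "alpha r (q * r + j) = (if even j then alpha r q else q mod r)"
proof (cases "q * r + j = 0")
  case True
  then show ?thesis using assms by (simp add: alpha.simps[of r 0])
next
  case False
  moreover have "(q * r + j) mod r = j" "(q * r + j) div r = q" using assms by simp_all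
  ultimately show ?thesis
    using assms(1) alpha.simps[of r "q * r + j"] by (simp only: not_less[symmetric] simp_thms if_False)
qed

lemma alpha_less: "0 < r \<Longrightarrow> alpha r N < r"
  by (induction r N rule: alpha.induct) (subst alpha.simps, auto)

section \<open>Reading words through adjacent letters\<close>

primrec scan :: "('a \<Rightarrow> 'a \<Rightarrow> 'b list) \<Rightarrow> 'a list \<Rightarrow> 'b list" where
  "scan F [] = []"
| "scan F (x # xs) = F x (hd xs) @ scan F xs"

text \<open>At the last letter of a word \<open>scan\<close> sees the unspecified
  \<open>hd []\<close>. Splitting is harmless if \<open>F\<close> ignores its second argument there,
  that is, if no pair is cut.\<close>

lemma scan_append:
  assumes "xs = [] \<or> (\<forall>b b'. F (last xs) b = F (last xs) b')"
  shows "scan F (xs @ ys) = scan F xs @ scan F ys"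
  using assms
proof (induction xs)
  case (Cons x xs)
  then show ?case by (cases "xs = []") auto
qed simp

lemma scan_concat:
  assumes "\<And>x. x \<in> set w \<Longrightarrow> f x = [] \<or> (\<forall>b b'. F (last (f x)) b = F (last (f x)) b')"
  shows "scan F (concat (map f w)) = concat (map (\<lambda>x. scan F (f x)) w)"
  using assms by (induction w) (simp_all add: scan_append)

lemma scan_map_upt:
  assumes "\<And>b b'. F (g (M - 1)) b = F (g (M - 1)) b'"
  shows "scan F (map g [N..<M]) = concat (map (\<lambda>i. F (g i) (g (Suc i))) [N..<M])"
proof (induction "M - N" arbitrary: N)
  case (Suc d)
  then have NM: "N < M" and IH: "scan F (map g [Suc N..<M]) = concat (map (\<lambda>i. F (g i) (g (Suc i))) [Suc N..<M])"
    by simp_all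
  have "F (g N) (hd (map g [Suc N..<M])) = F (g N) (g (Suc N))"
  proof (cases "Suc N < M")
    case False
    then have "N = M - 1" using NM by simp
    then show ?thesis using assms by simp
  qed (simp add: upt_conv_Cons)
  then show ?case using NM IH by (simp add: upt_conv_Cons del: upt_Suc)
qed simp

text \<open>For even \<open>c\<close>, columns \<open>c\<close> and \<open>c + 1\<close> of the
  block of a letter \<open>(i, k)\<close> carry \<open>i\<close> and \<open>k\<close>, so the pairs
  read here undo the substitution.\<close>

definition block_pairs :: "nat \<Rightarrow> (nat \<times> nat) list \<Rightarrow> (nat \<times> nat) list" where
  "block_pairs c = scan (\<lambda>a b. if snd a = c then [(fst a, fst b)] else [])"

definition label :: "nat \<Rightarrow> nat \<times> nat \<Rightarrow> nat" where
  "label j p = (if even j then fst p else snd p)"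

text \<open>\<open>True\<close> marks a pair read at column \<open>c\<close>, with the symbol it
  predicts for column \<open>j\<close> of its block; \<open>False\<close> marks the symbol found in
  column \<open>j\<close>.\<close>

definition events :: "nat \<Rightarrow> nat \<Rightarrow> (nat \<times> nat) list \<Rightarrow> (bool \<times> nat) list" where
  "events c j = scan (\<lambda>a b. if snd a = c then [(True, label j (fst a, fst b))]
     else if snd a = j then [(False, fst a)] else [])"

lemma filter_column_block_pairs:
  "filter (\<lambda>a. snd a = c) xs = map (\<lambda>p. (fst p, c)) (block_pairs c xs)"
  unfolding block_pairs_def by (induction xs) auto

lemma filter_events_block_pairs:
  "filter fst (events c j xs) = map (\<lambda>p. (True, label j p)) (block_pairs c xs)"
  unfolding block_pairs_def events_def by (induction xs) auto

lemma filter_column_events: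
  assumes "j \<noteq> c"
  shows "filter (\<lambda>a. snd a = j) xs = map (\<lambda>e. (snd e, j)) (filter (\<lambda>e. \<not> fst e) (events c j xs))"
  unfolding events_def using assms by (induction xs) auto

text \<open>Block \<open>q\<close> contributes iff its column \<open>c\<close> lies in the factor,
  and \<open>(N + (r - 1 - c)) div r\<close> is the least \<open>q\<close> with
  \<open>N <= q * r + c\<close>.\<close>

lemma block_pairs_factor:
  assumes r: "2 \<le> r" and c: "even c" "Suc c < r" and last: "(M - 1) mod r \<noteq> c" and NM: "N \<le> M"
  shows "block_pairs c (map (letter r) [N..<M]) =
    map (letter r) [(N + (r - 1 - c)) div r..<(M + (r - 1 - c)) div r]"
proof -
  let ?F = "\<lambda>i. if i mod r = c then [(alpha r i, alpha r (Suc i))] else []"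
  let ?cl = "\<lambda>N. (N + (r - 1 - c)) div r"
  \<comment> \<open>Passing position \<open>M\<close> raises \<open>?cl\<close> by one exactly when
    \<open>M\<close> lies in column \<open>c\<close>, and then one letter is read.\<close>
  have block: "?F M = map (letter r) [?cl M..<?cl (Suc M)] \<and> ?cl M \<le> ?cl (Suc M)" for M
  proof -
    define q j where "q = M div r" and "j = M mod r"
    have M: "M = q * r + j" and j: "j < r" using r by (simp_all add: q_def j_def)
    have div: "(q * r + i) div r = q" if "i < r" for q i
      using that by simp
    have div': "(q * r + r + i) div r = Suc q" if "i < r" for i
    proof -
      have "q * r + r + i = Suc q * r + i" by simp
      then show ?thesis using div[OF that, of "Suc q"] by (simp only:)
    qed
    show ?thesis
    proof (cases "j = c")
      case True
      have "?cl M = q" using div[of "r - 1"] M True c r by simp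
      moreover have "?cl (Suc M) = Suc q" using div'[of 0] M True c r by simp
      moreover have "?F M = [letter r q]"
        using alpha_block[OF r, of c q] alpha_block[OF r, of "Suc c" q] M True c
        by (simp add: letter_def)
      ultimately show ?thesis by simp
    next
      case False
      then have F: "?F M = []" using M j by simp
      show ?thesis
      proof (cases "j < c")
        case True
        have "?cl M = q" using div[of "j + (r - 1 - c)"] M True c r by (simp add: ac_simps)
        moreover have "?cl (Suc M) = q"
          using div[of "Suc j + (r - 1 - c)"] M True c r by (simp add: ac_simps)
        ultimately show ?thesis using F by simp
      next
        case False
        then have cj: "c < j" using \<open>j \<noteq> c\<close> by simp
        have eq: "M + (r - 1 - c) = q * r + r + (j - 1 - c)"
          "Suc M + (r - 1 - c) = q * r + r + (j - c)"
          using M j cj by linarith+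
        have "j - 1 - c < r" "j - c < r" using j by linarith+
        then have "?cl M = Suc q" "?cl (Suc M) = Suc q" unfolding eq by (simp_all only: div')
        then show ?thesis using F by simp
      qed
    qed
  qed
  have "concat (map ?F [N..<M]) = map (letter r) [?cl N..<?cl M]"
    using NM
  proof (induction M rule: dec_induct)
    case (step M)
    have le: "?cl N \<le> ?cl M" using step(1) by (intro div_le_mono) simp
    from block[of M] obtain F: "?F M = map (letter r) [?cl M..<?cl (Suc M)]"
      and le': "?cl M \<le> ?cl (Suc M)" by (rule conjE)
    have "[?cl N..<?cl (Suc M)] = [?cl N..<?cl M] @ [?cl M..<?cl (Suc M)]"
      using upt_add_eq_append[OF le, of "?cl (Suc M) - ?cl M"] le_add_diff_inverse[OF le'] by (simp only:)
    then have "map (letter r) [?cl N..<?cl (Suc M)] = concat (map ?F [N..<M]) @ ?F M"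
      unfolding F step.IH by (simp only: map_append)
    moreover have "concat (map ?F [N..<Suc M]) = concat (map ?F [N..<M]) @ ?F M"
      using step(1) by (simp only: upt_Suc_append map_append concat_append) simp
    ultimately show ?case by (simp only:)
  qed simp
  moreover have "block_pairs c (map (letter r) [N..<M]) = concat (map ?F [N..<M])"
    unfolding block_pairs_def
    by (subst scan_map_upt) (use last in \<open>simp_all add: letter_def cong: if_cong\<close>)
  ultimately show ?thesis by simp
qed

text \<open>In a factor, an event of column \<open>j\<close> carries the label read off the columns \<open>c\<close> and \<open>c + 1\<close>
  of the same block. As a cut between the two events of a block shows this label on both of its
  sides, it can serve as the vertex at that cut.\<close>

definition source :: "bool \<Rightarrow> bool \<times> nat \<Rightarrow> nat option" where
  "source b e = (if fst e = b then None else Some (snd e))"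

definition target :: "bool \<Rightarrow> bool \<times> nat \<Rightarrow> nat option" where
  "target b e = (if fst e = b then Some (snd e) else None)"

text \<open>A full block has one event of each kind. The earlier leads from \<open>None\<close> to
  the common label, the later back to \<open>None\<close>; \<open>c < j\<close> tells which kind is
  earlier.\<close>

lemma events_factor:
  assumes r: "2 \<le> r" and c: "even c" "Suc c < r" and j: "j < r" "j \<noteq> c"
    and last: "(M - 1) mod r \<noteq> c" and NM: "N \<le> M"
  shows "\<exists>a z. path (source (c < j)) (target (c < j)) a (events c j (map (letter r) [N..<M])) z"
proof -
  \<comment> \<open>The vertex at the cut before position \<open>N\<close>: the label if the cut
    separates the two event columns of its block, otherwise \<open>None\<close>.\<close>
  define state where "state N = (if min c j < N mod r \<and> N mod r \<le> max c j
    then Some (alpha r (N div r * r + j)) else None)" for N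
  let ?F = "\<lambda>i. if i mod r = c then [(True, label j (alpha r i, alpha r (Suc i)))]
     else if i mod r = j then [(False, alpha r i)] else []"
  let ?path = "path (source (c < j)) (target (c < j))"
  have block: "?path (state i) (?F i) (state (Suc i))" for i
  proof -
    define q k where "q = i div r" and "k = i mod r"
    have i: "i = q * r + k" and k: "k < r" using r by (simp_all add: q_def k_def)
    have lab: "label j (alpha r (q * r + c), alpha r (Suc (q * r + c))) = alpha r (q * r + j)"
      using alpha_block[OF r, of c q] alpha_block[OF r, of "Suc c" q] alpha_block[OF r, of j q] c j
      by (simp add: label_def)
    have st: "state i = (if min c j < k \<and> k \<le> max c j then Some (alpha r (q * r + j)) else None)"
      using i k by (simp add: state_def)
    have st': "state (Suc i) =
        (if min c j \<le> k \<and> k < max c j then Some (alpha r (q * r + j)) else None)"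
    proof (cases "Suc k = r")
      case True
      then have "Suc i = Suc q * r" using i by simp
      then have "Suc i mod r = 0" by (simp only: mod_mult_self2_is_0)
      then show ?thesis using True c j by (auto simp: state_def)
    next
      case False
      then have "Suc i = q * r + Suc k" "Suc k < r" using i k by simp_all
      moreover have "(q * r + m) mod r = m" "(q * r + m) div r = q" if "m < r" for m
        using that by simp_all
      ultimately have "Suc i mod r = Suc k" "Suc i div r = q" by (simp_all only:)
      then show ?thesis by (auto simp: state_def)
    qed
    have im: "i mod r = k" by (simp add: k_def)
    show ?thesis
      unfolding st st' im
      using lab j i by (auto simp: source_def target_def)
  qed
  have "?path (state N) (concat (map ?F [N..<M])) (state M)"
    using NM
  proof (induction M rule: dec_induct)
    case (step M)
    then show ?case
      using block[of M]
      by (simp only: upt_Suc_append map_append concat_append path_append) auto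
  qed simp
  moreover have "events c j (map (letter r) [N..<M]) = concat (map ?F [N..<M])"
    unfolding events_def
    by (subst scan_map_upt) (use last in \<open>simp_all add: letter_def cong: if_cong\<close>)
  ultimately show ?thesis by auto
qed

text \<open>The vertex reached decides the kind of the next event. Labels of pair events are given;
  that of a column event is shown at its \<open>Some\<close> end, which is shared with an adjacent
  pair event or is \<open>a\<close> or \<open>z\<close>.\<close>

lemma events_unique:
  assumes "path (source b) (target b) a es z" "path (source b) (target b) a es' z"
    and "filter fst es = filter fst es'"
  shows "es = es'"
  using assms
proof (induction es arbitrary: a es')
  case Nil
  show ?case
  proof (cases es')
    case (Cons e xs)
    with Nil show ?thesis by (cases xs; cases "fst e"; cases b) (auto simp: source_def target_def split: if_splits)
  qed simp
next
  case (Cons e es)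
  show ?case
  proof (cases es')
    case Nil
    with Cons.prems show ?thesis by (cases es; cases "fst e"; cases b) (auto simp: source_def target_def split: if_splits)
  next
    case es': (Cons e' xs)
    have "fst e = fst e'" using Cons.prems es'
      by (cases b; cases "fst e"; cases "fst e'") (auto simp: source_def)
    moreover have "snd e = snd e'" using Cons.prems es' calculation
      by (cases b; cases "fst e"; cases es; cases xs) (auto simp: source_def target_def split: if_splits)
    ultimately have "e = e'" by (rule prod_eqI)
    then have "es = xs" using Cons.prems es' by (intro Cons.IH[of "target b e"]) (auto split: if_splits)
    then show ?thesis using es' \<open>e = e'\<close> by simp
  qed
qed

text \<open>The vertex reached names the column of the next letter, which is the first letter left
  in that column.\<close>

lemma eq_if_columns_eq:
  assumes "path snd t a xs z" "path snd t a ys z'"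
    and "\<And>j. filter (\<lambda>x. snd x = j) xs = filter (\<lambda>x. snd x = j) ys"
  shows "xs = ys"
  using assms
proof (induction xs arbitrary: a ys)
  case Nil
  from Nil.prems(3)[of "snd (hd ys)"] show ?case by (cases ys) simp_all
next
  case (Cons x xs)
  from Cons.prems(3)[of "snd x"] obtain y ys' where ys: "ys = y # ys'" by (cases ys) auto
  have "x = y" using Cons.prems(1,2) Cons.prems(3)[of "snd x"] ys by simp
  moreover have "xs = ys'"
  proof (rule Cons.IH)
    show "path snd t (t x) xs z" "path snd t (t x) ys' z'" using Cons.prems(1,2) ys \<open>x = y\<close> by simp_all
    show "filter (\<lambda>x. snd x = j) xs = filter (\<lambda>x. snd x = j) ys'" for j
      using Cons.prems(3)[of j] ys \<open>x = y\<close> by (simp split: if_splits)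
  qed
  ultimately show ?case using ys by simp
qed


text \<open>Induction on the length: desubstitution at an uncut pair of columns gives a shorter
  factor with images \<open>block_pairs c (f x)\<close>. Once the blocks are known, events recover
  each further column, and a path through the columns fixes their interleaving.\<close>

lemma admissible_factor:
  assumes adm: "admissible P u" and P: "P \<noteq> {}" "\<And>w. w \<in> P \<Longrightarrow> set w \<subseteq> {..<n}"
    and r: "r = 2 * Suc n"
    and "\<And>w. w \<in> P \<Longrightarrow> concat (map f w) = map (letter r) [N..<M]"
  shows "concat (map f u) = map (letter r) [N..<M]"
  using assms(5)
proof (induction "M - N" arbitrary: N M f rule: less_induct)
  case less
  note f = less.prems
  have content: "set u \<subseteq> (\<Union>w\<in>P. set w)" using adm by (simp add: admissible_def)
  show ?case
  proof (cases "N < M")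
    case False
    then have "f x = []" if "x \<in> set u" for x using f content that by fastforce
    then show ?thesis using False by simp
  next
    case NM: True
    have r2: "2 \<le> r" using r by simp
    \<comment> \<open>There are more pairs of columns \<open>2k\<close>, \<open>2k + 1\<close> than letters, so some pair is never cut.\<close>
    have "card ((\<lambda>x. snd (last (f x)) div 2) ` {..<n}) \<le> n" by (metis card_image_le card_lessThan finite_lessThan)
    then have "\<not> {..n} \<subseteq> (\<lambda>x. snd (last (f x)) div 2) ` {..<n}"
      using card_mono[of "(\<lambda>x. snd (last (f x)) div 2) ` {..<n}" "{..n}"] by auto
    then obtain k where k: "k \<le> n" "k \<notin> (\<lambda>x. snd (last (f x)) div 2) ` {..<n}" by auto
    define c where "c = 2 * k"
    have c: "even c" "Suc c < r" using k(1) r by (simp_all add: c_def)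
    have cut: "snd (last (f x)) \<noteq> c" if "x < n" for x
      using k(2) that by (force simp: c_def)
    have small: "x < n" if "x \<in> set w" "w \<in> insert u P" for x w
      using that P(2) content by fastforce
    \<comment> \<open>No nonempty image of a letter of these words ends in column \<open>c\<close>,
      so concatenation cuts no pair.\<close>
    have pairs_concat: "block_pairs c (concat (map f w)) = concat (map (\<lambda>x. block_pairs c (f x)) w)"
      and events_concat: "j \<noteq> c \<Longrightarrow> events c j (concat (map f w)) = concat (map (\<lambda>x. events c j (f x)) w)"
      if "w \<in> insert u P" for w j
      unfolding block_pairs_def events_def
      by (rule scan_concat; use cut small that in auto)+
    obtain w0 where w0: "w0 \<in> P" using P(1) by auto
    have last: "(M - 1) mod r \<noteq> c"
    proof -
      have ne: "concat (map f w0) \<noteq> []" using f[OF w0] NM by simp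
      have "last (concat (map f w)) \<in> (\<lambda>x. last (f x)) ` set w" if "concat (map f w) \<noteq> []" for w
        using that by (induction w rule: rev_induct) (auto simp: last_append)
      from this[OF ne] have "snd (last (concat (map f w0))) \<noteq> c"
        using cut small[OF _ insertI2[OF w0]] by fastforce
      moreover have "last (concat (map f w0)) = letter r (M - 1)"
        using f[OF w0] NM by (simp add: last_map)
      ultimately show ?thesis by (simp add: letter_def)
    qed
    let ?v = "map (letter r) [N..<M]" and ?v' = "concat (map f u)"
    have pairs: "block_pairs c ?v' = block_pairs c ?v"
    proof -
      let ?N = "(N + (r - 1 - c)) div r" and ?M = "(M + (r - 1 - c)) div r"
      have v: "block_pairs c ?v = map (letter r) [?N..<?M]"
        using NM by (intro block_pairs_factor[OF r2 c last]) simp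
      \<comment> \<open>The desubstituted factor has one letter per entry of column
        \<open>c\<close>, and the last letter of \<open>?v\<close> lies outside that column, so the
        length drops.\<close>
      have "length (filter (\<lambda>a. snd a = c) ?v) < length ?v"
        by (rule length_filter_less[of "letter r (M - 1)"]) (use NM last in \<open>auto simp: letter_def\<close>)
      then have less': "?M - ?N < M - N"
        unfolding filter_column_block_pairs v by simp
      have "concat (map (\<lambda>x. block_pairs c (f x)) w) = map (letter r) [?N..<?M]" if "w \<in> P" for w
        using pairs_concat[of w] f[OF that] that v by simp
      from less.hyps[OF less' this] show ?thesis using pairs_concat[of u] v by simp
    qed
    have columns: "filter (\<lambda>x. snd x = j) ?v' = filter (\<lambda>x. snd x = j) ?v" if j: "j < r" for j
    proof (cases "j = c")
      case True
      then show ?thesis by (simp add: filter_column_block_pairs pairs)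
    next
      case False
      obtain a z where az: "path (source (c < j)) (target (c < j)) a (events c j ?v) z"
        using events_factor[OF r2 c j False last less_imp_le[OF NM]] by blast
      \<comment> \<open>Under the substitution \<open>events c j (f x)\<close> all words of
        \<open>P\<close> spell the events of \<open>?v\<close>, so the path carries over to
        \<open>u\<close>.\<close>
      have "path (source (c < j)) (target (c < j)) a (events c j ?v') z"
        unfolding events_concat[OF insertI1 False]
        by (rule admissible_path[OF adm])
          (use az f events_concat[OF insertI2 False] in \<open>metis\<close>)
      then have "events c j ?v' = events c j ?v"
        by (rule events_unique[OF _ az]) (simp add: filter_events_block_pairs pairs)
      then show ?thesis by (simp add: filter_column_events[OF False])
    qed
    \<comment> \<open>Here the vertices are the columns, each letter leading to the cyclically next
      one.\<close>
    have step: "path snd (\<lambda>x. Suc (snd x) mod r) (N mod r) ?v (M mod r)"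
      using NM[THEN less_imp_le]
      by (induction M rule: dec_induct) (auto simp: path_append letter_def mod_Suc_eq)
    have path: "path snd (\<lambda>x. Suc (snd x) mod r) (N mod r) ?v' (M mod r)"
      by (rule admissible_path[OF adm]) (simp add: f step)
    show ?thesis
    proof (rule eq_if_columns_eq[OF path step])
      fix j
      show "filter (\<lambda>x. snd x = j) ?v' = filter (\<lambda>x. snd x = j) ?v"
      proof (cases "j < r")
        case False
        have "snd x < r" if "x \<in> set ?v'" for x
        proof -
          from that obtain y w where "x \<in> set (f y)" "y \<in> set w" "w \<in> P" using content by auto
          then have "x \<in> set (concat (map f w))" by auto
          then show ?thesis using f[OF \<open>w \<in> P\<close>] r by (auto simp: letter_def)
        qed
        then have "filter (\<lambda>x. snd x = j) ?v' = []" using False by (auto simp: filter_empty_conv)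
        moreover have "filter (\<lambda>x. snd x = j) ?v = []"
          using False r by (auto simp: filter_empty_conv letter_def)
        ultimately show ?thesis by simp
      qed (rule columns)
    qed
  qed
qed


section \<open>The flat algebra of factors\<close>

definition factor :: "nat \<Rightarrow> (nat \<times> nat) list \<Rightarrow> bool" where
  "factor r v \<longleftrightarrow> (\<exists>N M. v = map (letter r) [N..<M])"

text \<open>\<open>None\<close> is the additive top and a multiplicative zero, and distinct factors
  sum to it. So a term has value \<open>Some g\<close> only if all its words spell
  \<open>g\<close>.\<close>

definition factor_alg :: "nat \<Rightarrow> (nat \<times> nat) list option alg" where
  "factor_alg r = \<lparr>carr = insert None (Some ` Collect (factor r)),
     add_op = \<lambda>x y. if x = y then x else None,
     mul_op = \<lambda>x y. case x of None \<Rightarrow> None | Some u \<Rightarrow>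
       (case y of None \<Rightarrow> None | Some v \<Rightarrow> if factor r (u @ v) then Some (u @ v) else None)\<rparr>"

lemma algebra_factor_alg: "algebra (factor_alg r)"
  by (auto simp: algebra_def factor_alg_def split: option.splits)

lemma factor_append:
  assumes "factor r (u @ v)"
  shows "factor r u" "factor r v"
proof -
  obtain N M where "u @ v = map (letter r) [N..<M]" using assms by (auto simp: factor_def)
  then have "u = take (length u) (map (letter r) [N..<M])" "v = drop (length u) (map (letter r) [N..<M])"
    and "length u \<le> M - N"
    by (metis append_eq_conv_conj, metis append_eq_conv_conj,
        metis le_add1 length_append length_map length_upt)
  then have "u = map (letter r) [N..<N + length u]" "v = map (letter r) [N + length u..<M]"
    using take_upt[of N "length u" M] by (cases "N \<le> M"; simp add: take_map drop_map drop_upt)+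
  then show "factor r u" "factor r v" by (auto simp: factor_def)
qed

lemma eval_factor_alg:
  assumes "range v \<subseteq> carr (factor_alg r)"
  shows "eval_trm (factor_alg r) v t = Some g \<longleftrightarrow> factor r g \<and>
    (\<forall>w\<in>words t. (\<forall>x\<in>set w. v x \<noteq> None) \<and> concat (map (\<lambda>x. the (v x)) w) = g)"
proof (induction t arbitrary: g)
  case (Var x)
  have "v x \<in> carr (factor_alg r)" using assms by auto
  then show ?case by (auto simp: factor_alg_def)
next
  case (Add s t)
  have "eval_trm (factor_alg r) v (Add s t) = Some g \<longleftrightarrow>
      eval_trm (factor_alg r) v s = Some g \<and> eval_trm (factor_alg r) v t = Some g"
    by (auto simp: factor_alg_def)
  then show ?case using Add by auto
next
  case (Mul s t)
  let ?c = "\<lambda>w. concat (map (\<lambda>x. the (v x)) w)"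
  have "eval_trm (factor_alg r) v (Mul s t) = Some g \<longleftrightarrow> factor r g \<and>
      (\<exists>h k. eval_trm (factor_alg r) v s = Some h \<and> eval_trm (factor_alg r) v t = Some k \<and> h @ k = g)"
    by (auto simp: factor_alg_def split: option.splits)
  also have "\<dots> \<longleftrightarrow> factor r g \<and> (\<forall>w\<in>words (Mul s t). (\<forall>x\<in>set w. v x \<noteq> None) \<and> ?c w = g)"
  proof (intro iffI conjI; (elim conjE)?)
    assume "\<exists>h k. eval_trm (factor_alg r) v s = Some h \<and> eval_trm (factor_alg r) v t = Some k \<and> h @ k = g"
    then show "\<forall>w\<in>words (Mul s t). (\<forall>x\<in>set w. v x \<noteq> None) \<and> ?c w = g"
      unfolding Mul.IH by fastforce
  next
    assume g: "factor r g" and all: "\<forall>w\<in>words (Mul s t). (\<forall>x\<in>set w. v x \<noteq> None) \<and> ?c w = g"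
    \<comment> \<open>With one word fixed on each side, cancellation shows that all words of the
      other side spell the same factor.\<close>
    obtain a b where ab: "a \<in> words s" "b \<in> words t" using words_nonempty by blast
    have split: "(\<forall>x\<in>set a'. v x \<noteq> None) \<and> (\<forall>x\<in>set b'. v x \<noteq> None) \<and> ?c a' @ ?c b' = g"
      if "a' \<in> words s" "b' \<in> words t" for a' b'
    proof -
      have "a' @ b' \<in> words (Mul s t)" using that by auto
      from bspec[OF all this] show ?thesis by auto
    qed
    have "factor r (?c a)" "factor r (?c b)"
      using factor_append[of r "?c a" "?c b"] g split[OF ab] by auto
    moreover have "?c a' = ?c a" if "a' \<in> words s" for a'
      using split[OF that ab(2)] split[OF ab] by (metis append_same_eq)
    moreover have "?c b' = ?c b" if "b' \<in> words t" for b'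
      using split[OF ab(1) that] split[OF ab] by (metis same_append_eq)
    ultimately have "eval_trm (factor_alg r) v s = Some (?c a)" "eval_trm (factor_alg r) v t = Some (?c b)"
      unfolding Mul.IH using split ab by blast+
    then show "\<exists>h k. eval_trm (factor_alg r) v s = Some h \<and> eval_trm (factor_alg r) v t = Some k \<and> h @ k = g"
      using split[OF ab] by blast
  qed auto
  finally show ?case .
qed

lemma infinite_factor_alg: "infinite (carr (factor_alg r))"
proof
  assume "finite (carr (factor_alg r))"
  moreover have "Some ` (\<lambda>M. map (letter r) [0..<M]) ` UNIV \<subseteq> carr (factor_alg r)"
    unfolding factor_alg_def factor_def by auto
  ultimately have "finite (range (\<lambda>M. map (letter r) [0..<M]))"
    by (metis finite_imageD finite_subset inj_Some inj_on_subset subset_UNIV)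
  moreover have "inj (\<lambda>M. map (letter r) [0..<M])"
    by (rule injI) (metis diff_zero length_map length_upt)
  ultimately show False using finite_imageD infinite_UNIV_nat by blast
qed

text \<open>There are at most \<open>r * r\<close> letters, and a factor is built letter by letter
  through its prefixes, which are factors.\<close>

lemma finitely_generated_factor_alg:
  assumes "0 < r"
  shows "finitely_generated (factor_alg r)"
proof -
  let ?A = "factor_alg r"
  let ?X = "insert None (insert (Some []) (range (\<lambda>N. Some [letter r N])))"
  have "range (letter r) \<subseteq> {..<r} \<times> {..<r}"
    using assms by (auto simp: letter_def alpha_less)
  then have "finite (range (letter r))" by (rule finite_subset) simp
  then have "finite ((\<lambda>a. Some [a]) ` range (letter r))" by (rule finite_imageI)
  then have fin: "finite ?X" by (simp add: image_image)
  have "factor r [letter r N]" for N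
    unfolding factor_def by (intro exI[of _ N] exI[of _ "Suc N"]) simp
  moreover have "factor r []"
    unfolding factor_def by (intro exI[of _ 0]) simp
  ultimately have X: "?X \<subseteq> carr ?A" by (auto simp: factor_alg_def)
  have gen: "Some (map (letter r) [N..<M]) \<in> generated ?A ?X" for N M
  proof (induction M)
    case 0
    show ?case by (rule generated.gen_base) simp
  next
    case (Suc M)
    show ?case
    proof (cases "N \<le> M")
      case True
      have "Some [letter r M] \<in> generated ?A ?X" by (rule generated.gen_base) simp
      from generated.gen_mul[OF Suc this] have "mul_op ?A (Some (map (letter r) [N..<M])) (Some [letter r M]) \<in> generated ?A ?X" .
      moreover have "factor r (map (letter r) [N..<M] @ [letter r M])"
        unfolding factor_def using True by (intro exI[of _ N] exI[of _ "Suc M"]) simp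
      ultimately show ?thesis using True by (simp add: factor_alg_def)
    next
      case False
      show ?thesis by (rule generated.gen_base) (use False in simp)
    qed
  qed
  have "carr ?A \<subseteq> generated ?A ?X"
  proof
    fix x assume "x \<in> carr ?A"
    then consider "x = None" | v where "factor r v" "x = Some v" unfolding factor_alg_def by auto
    then show "x \<in> generated ?A ?X"
    proof cases
      case 1
      show ?thesis unfolding 1 by (rule generated.gen_base) simp
    next
      case 2
      then obtain N M where "v = map (letter r) [N..<M]" unfolding factor_def by blast
      then show ?thesis using 2(2) gen by simp
    qed
  qed
  then show ?thesis
    unfolding finitely_generated_def
    using fin X generated_subset_carr[OF algebra_factor_alg X] by blast
qed

text \<open>The only property of the identities of \<open>B21\<close> and \<open>A21\<close> that
  the construction of the infinite algebra relies on.\<close>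

definition rigid :: "'a alg \<Rightarrow> bool" where
  "rigid A \<longleftrightarrow> (\<forall>s t. satisfies A {(s, t)} \<longrightarrow> (\<forall>u\<in>words t. admissible (words s) u))"

text \<open>If \<open>s\<close> has value \<open>Some g\<close>, its words all spell
  \<open>g\<close>, and admissibility makes the words of \<open>t\<close> spell \<open>g\<close>
  too; the converse is symmetric.\<close>

lemma satisfies_factor_alg:
  assumes A: "rigid A" and E: "satisfies A E" and vars: "\<And>s t. (s, t) \<in> E \<Longrightarrow> vars s \<union> vars t \<subseteq> {..<n}"
  shows "satisfies (factor_alg (2 * Suc n)) E"
proof -
  let ?S = "factor_alg (2 * Suc n)"
  have main: "eval_trm ?S v t = Some g"
    if v: "range v \<subseteq> carr ?S" and s: "eval_trm ?S v s = Some g"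
      and sat: "satisfies A {(s, t)}" and n: "vars s \<subseteq> {..<n}" for s t v g
  proof -
    let ?c = "\<lambda>w. concat (map (\<lambda>x. the (v x)) w)"
    have g: "factor (2 * Suc n) g" and
      w: "\<And>w. w \<in> words s \<Longrightarrow> (\<forall>x\<in>set w. v x \<noteq> None) \<and> ?c w = g"
      using s unfolding eval_factor_alg[OF v] by auto
    obtain N M where NM: "g = map (letter (2 * Suc n)) [N..<M]" using g unfolding factor_def by blast
    have "(\<forall>x\<in>set u. v x \<noteq> None) \<and> ?c u = g" if "u \<in> words t" for u
    proof -
      have adm: "admissible (words s) u" using A sat that by (auto simp: rigid_def)
      have "?c u = g" unfolding NM
        by (rule admissible_factor[OF adm words_nonempty _ refl])
          (use n words_vars w NM in \<open>blast+\<close>)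
      moreover have "set u \<subseteq> (\<Union>w\<in>words s. set w)" using adm by (simp add: admissible_def)
      ultimately show ?thesis using w by blast
    qed
    then show ?thesis using g unfolding eval_factor_alg[OF v] by blast
  qed
  show ?thesis
    unfolding satisfies_def
  proof clarify
    fix s t and v :: "nat \<Rightarrow> _" assume st: "(s, t) \<in> E" and v: "range v \<subseteq> carr ?S"
    have sat: "satisfies A {(s, t)}" by (rule satisfies_subset[OF E]) (use st in simp)
    have n: "vars s \<subseteq> {..<n}" "vars t \<subseteq> {..<n}" using vars[OF st] by simp_all
    have "eval_trm ?S v s = Some g \<longleftrightarrow> eval_trm ?S v t = Some g" for g
      by (rule iffI) (erule main[OF v _ sat n(1)] main[OF v _ satisfies_swap[OF sat] n(2)])+
    then show "eval_trm ?S v s = eval_trm ?S v t"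
      by (cases "eval_trm ?S v s"; cases "eval_trm ?S v t") simp_all
  qed
qed

text \<open>A finite basis has finitely many variables, so its variety contains a flat algebra of
  factors, which is finitely generated and infinite.\<close>

lemma inherently_nonfinitely_based_if_rigid:
  fixes A :: "'a alg"
  assumes inf: "infinite (UNIV :: 'u set)" and alg: "algebra A"
    and fin: "finite (UNIV :: 'a set)" and rigid: "rigid A"
  shows "inherently_nonfinitely_based_algebra TYPE('u) A"
proof -
  obtain h :: "nat \<Rightarrow> 'u" where h: "inj h" using inf by (auto simp: infinite_iff_countable_subset)
  obtain i :: "'a \<Rightarrow> nat" where i: "inj i" using finite_imp_inj_to_nat_seg[OF fin] by blast
  define g where "g x = h (i x)" for x
  have g: "inj g" using h i by (simp add: g_def inj_def)
  have "locally_finite (variety_generated_by A :: 'u alg set)"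
    by (rule locally_finite_variety_generated_by[OF alg]) (rule finite_subset[OF _ fin], simp)
  moreover have False
    if W: "finitely_based W" "locally_finite W" "variety_generated_by A \<subseteq> W" for W :: "'u alg set"
  proof -
    obtain E where E: "finite E" "W = models E" using W(1) by (auto simp: finitely_based_def)
    \<comment> \<open>Membership in \<open>W\<close> makes sense only for algebras over
      \<open>'u\<close>; the copy passes the identities \<open>E\<close> back to
      \<open>A\<close>.\<close>
    have "copy g A \<in> variety_generated_by A"
      using algebra_copy[OF g alg] satisfies_copy[OF g, of A]
      by (auto simp: variety_generated_by_def models_def)
    then have sat: "satisfies A E"
      using W(3) E(2) satisfies_copy[OF g, of A E] by (auto simp: models_def)
    have "finite (\<Union>(s, t)\<in>E. vars s \<union> vars t)" using E(1) finite_vars by auto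
    then obtain n where "(\<Union>(s, t)\<in>E. vars s \<union> vars t) \<subseteq> {..<n}"
      using finite_nat_bounded by blast
    then have n: "vars s \<union> vars t \<subseteq> {..<n}" if "(s, t) \<in> E" for s t
      using that by fastforce
    let ?S = "factor_alg (2 * Suc n)"
    \<comment> \<open>The flat algebra lives in a countable type, so it embeds into any infinite
      one.\<close>
    define k :: "(nat \<times> nat) list option \<Rightarrow> 'u" where "k x = h (to_nat x)" for x
    have k: "inj k" using inj_compose[OF h inj_to_nat] by (simp add: k_def[abs_def] comp_def)
    have "copy k ?S \<in> W"
      using satisfies_factor_alg[OF rigid sat n] satisfies_copy[OF k, of ?S E]
        algebra_copy[OF k algebra_factor_alg] by (auto simp: E(2) models_def)
    moreover have "finitely_generated (copy k ?S)"
      by (rule finitely_generated_copy[OF k algebra_factor_alg finitely_generated_factor_alg]) simp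
    ultimately have "finite (carr (copy k ?S))" using W(2) by (auto simp: locally_finite_def)
    then have "finite (k ` carr ?S)" by (simp add: copy_def)
    then show False
      using infinite_factor_alg finite_imageD inj_on_subset[OF k subset_UNIV] by blast
  qed
  ultimately show ?thesis
    unfolding inherently_nonfinitely_based_algebra_def inherently_nonfinitely_based_def
    using variety_variety_generated_by by blast
qed


section \<open>Rigidity of \<open>B21\<close> and \<open>A21\<close>\<close>

locale unital_ai_semiring =
  fixes A :: "'a alg" and unit :: 'a
  assumes ai: "ai_semiring A" and UNIV: "carr A = UNIV"
    and unit: "mul_op A unit x = x" "mul_op A x unit = x"
begin

abbreviation add (infixl "\<oplus>" 65) where "x \<oplus> y \<equiv> add_op A x y"
abbreviation mul (infixl "\<odot>" 70) where "x \<odot> y \<equiv> mul_op A x y"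

lemma semiring_laws:
  "x \<oplus> y \<oplus> z = x \<oplus> (y \<oplus> z)" "x \<oplus> y = y \<oplus> x" "x \<oplus> x = x" "x \<odot> y \<odot> z = x \<odot> (y \<odot> z)"
  "x \<odot> (y \<oplus> z) = x \<odot> y \<oplus> x \<odot> z" "(x \<oplus> y) \<odot> z = x \<odot> z \<oplus> y \<odot> z"
  using ai unfolding ai_semiring_def UNIV by blast+

definition le (infix "\<sqsubseteq>" 50) where "x \<sqsubseteq> y \<longleftrightarrow> x \<oplus> y = y"

lemma le_trans: "x \<sqsubseteq> y \<Longrightarrow> y \<sqsubseteq> z \<Longrightarrow> x \<sqsubseteq> z"
  unfolding le_def by (metis semiring_laws(1))

lemma add_le_iff: "x \<oplus> y \<sqsubseteq> z \<longleftrightarrow> x \<sqsubseteq> z \<and> y \<sqsubseteq> z"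
  unfolding le_def by (metis semiring_laws(1-3))

lemma mul_mono: "x \<sqsubseteq> x' \<Longrightarrow> y \<sqsubseteq> y' \<Longrightarrow> x \<odot> y \<sqsubseteq> x' \<odot> y'"
  by (rule le_trans[of _ "x' \<odot> y"]) (metis le_def semiring_laws(5,6))+

text \<open>Ending in \<open>unit\<close> gives the empty word a value; a letter sent to
  \<open>unit\<close> drops out of every word.\<close>

definition value_of :: "(nat \<Rightarrow> 'a) \<Rightarrow> nat list \<Rightarrow> 'a" where
  "value_of v w = foldr (\<lambda>x y. v x \<odot> y) w unit"

lemma value_of_simps [simp]: "value_of v [] = unit" "value_of v (x # w) = v x \<odot> value_of v w"
  by (simp_all add: value_of_def)

lemma value_of_append: "value_of v (u @ w) = value_of v u \<odot> value_of v w"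
  by (induction u) (simp_all add: unit semiring_laws(4))

lemma word_le: "w \<in> words t \<Longrightarrow> value_of v w \<sqsubseteq> eval_trm A v t"
proof (induction t arbitrary: w)
  case (Var x)
  then show ?case by (simp add: unit le_def semiring_laws(3))
next
  case (Add s t)
  have "eval_trm A v s \<sqsubseteq> eval_trm A v (Add s t)" "eval_trm A v t \<sqsubseteq> eval_trm A v (Add s t)"
    unfolding le_def eval_trm.simps by (metis semiring_laws(1-3))+
  then show ?case using Add by (auto elim: le_trans[rotated])
next
  case (Mul s t)
  then obtain u u' where w: "w = u @ u'" "u \<in> words s" "u' \<in> words t" by auto
  show ?case
    unfolding w(1) value_of_append eval_trm.simps by (rule mul_mono[OF Mul.IH(1)[OF w(2)] Mul.IH(2)[OF w(3)]])
qed

text \<open>A term is the join of its words. The context \<open>x\<close>, \<open>y\<close> holds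
  the rest of a product during the induction.\<close>

lemma eval_le:
  assumes "\<And>w. w \<in> words t \<Longrightarrow> x \<odot> (value_of v w \<odot> y) \<sqsubseteq> e"
  shows "x \<odot> (eval_trm A v t \<odot> y) \<sqsubseteq> e"
  using assms
proof (induction t arbitrary: x y)
  case (Var n)
  from Var[of "[n]"] show ?case by (simp add: unit)
next
  case (Add s t)
  then show ?case by (simp add: semiring_laws(5,6) add_le_iff)
next
  case (Mul s t)
  have "x \<odot> (eval_trm A v s \<odot> (eval_trm A v t \<odot> y)) \<sqsubseteq> e"
  proof (rule Mul.IH(1))
    fix u assume u: "u \<in> words s"
    have "(x \<odot> value_of v u) \<odot> (eval_trm A v t \<odot> y) \<sqsubseteq> e"
    proof (rule Mul.IH(2))
      fix w assume "w \<in> words t"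
      then have "u @ w \<in> words (Mul s t)" using u by auto
      from Mul.prems[OF this] show "(x \<odot> value_of v u) \<odot> (value_of v w \<odot> y) \<sqsubseteq> e"
        by (simp add: value_of_append semiring_laws(4))
    qed
    then show "x \<odot> (value_of v u \<odot> (eval_trm A v t \<odot> y)) \<sqsubseteq> e" by (simp add: semiring_laws(4))
  qed
  then show ?case by (simp add: semiring_laws(4))
qed

lemma identity_le:
  assumes "satisfies A {(s, t)}" "u \<in> words t" "\<And>w. w \<in> words s \<Longrightarrow> value_of v w \<sqsubseteq> e"
  shows "value_of v u \<sqsubseteq> e"
proof -
  have "eval_trm A v s = eval_trm A v t" using assms(1) by (simp add: satisfies_def UNIV)
  then show ?thesis
    using word_le[OF assms(2), of v] eval_le[of s unit v unit e] assms(3) le_trans by (simp add: unit)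
qed

text \<open>Send a letter of \<open>u\<close> missing from \<open>words s\<close> to
  \<open>zero\<close> and all others to \<open>unit\<close>: then \<open>u\<close> gives
  \<open>zero\<close> and all words of \<open>s\<close> give \<open>unit\<close>.\<close>

lemma content_subset:
  assumes "satisfies A {(s, t)}" "u \<in> words t"
    and zero: "\<And>x. mul_op A x zero = zero" "\<And>x. mul_op A zero x = zero" "\<not> zero \<sqsubseteq> unit"
  shows "set u \<subseteq> (\<Union>w\<in>words s. set w)"
proof (rule ccontr)
  assume "\<not> ?thesis"
  then obtain x where x: "x \<in> set u" "\<And>w. w \<in> words s \<Longrightarrow> x \<notin> set w" by auto
  let ?v = "\<lambda>y. if y = x then zero else unit"
  have "x \<notin> set w \<Longrightarrow> value_of ?v w = unit" "x \<in> set w \<Longrightarrow> value_of ?v w = zero" for w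
    by (induction w) (auto simp: unit zero)
  moreover have "unit \<sqsubseteq> unit" by (simp add: le_def semiring_laws(3))
  ultimately show False
    using identity_le[OF assms(1,2), of ?v unit] x zero(3) by metis
qed

text \<open>\<open>m p q\<close> is an edge and \<open>e a z\<close> an upper bound. The second
  hypothesis strips the first letter of a product and moves the start vertex along; the first ends
  the walk.\<close>

lemma value_of_walk:
  assumes "\<And>a z. unit \<sqsubseteq> e a z \<longleftrightarrow> R a z"
    and "\<And>p q a z y. m p q \<odot> y \<sqsubseteq> e a z \<longleftrightarrow> R a p \<and> y \<sqsubseteq> e q z"
  shows "value_of (\<lambda>x. if K x then m (s x) (t x) else unit) w \<sqsubseteq> e a z \<longleftrightarrow>
    walk R s t a (filter K w) z"
  using assms by (induction w arbitrary: a) (auto simp: unit)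

lemma identity_walk:
  assumes "satisfies A {(p, q)}" "u \<in> words q"
    and "\<And>a z. unit \<sqsubseteq> e a z \<longleftrightarrow> R a z"
    and "\<And>p q a z y. m p q \<odot> y \<sqsubseteq> e a z \<longleftrightarrow> R a p \<and> y \<sqsubseteq> e q z"
    and "\<And>w. w \<in> words p \<Longrightarrow> walk R s t a (filter K w) z"
  shows "walk R s t a (filter K u) z"
  using identity_le[OF assms(1,2)] assms(5) value_of_walk[of e R m, OF assms(3,4)] by metis

end

section \<open>Matrix units in \<open>B21\<close> and \<open>A21\<close>\<close>

interpretation B: unital_ai_semiring B21 B1
  by unfold_locales (simp_all add: ai_semiring_B21, simp_all add: B21_def B21_relations)

interpretation A: unital_ai_semiring A21 A1
  by unfold_locales (simp_all add: ai_semiring_A21, simp_all add: A21_def A21_relations)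

lemma B21_ops:
  "mul_op B21 = B21_mul"
  "B.le x y \<longleftrightarrow> x = y \<or> y = B0 \<or> x = B1 \<and> (y = Bcd \<or> y = Bdc)"
proof -
  have "B.le x y \<longleftrightarrow> B21_add x y = y" unfolding B.le_def by (simp add: B21_def)
  then show "B.le x y \<longleftrightarrow> x = y \<or> y = B0 \<or> x = B1 \<and> (y = Bcd \<or> y = Bdc)"
    by (cases x; cases y) (simp_all add: B21_add_def doubleton_eq_iff)
qed (simp add: B21_def)

lemma A21_ops: "mul_op A21 = A21_mul" "A.le x y \<longleftrightarrow> A21_add x y = y"
  by (simp add: A21_def, simp only: A.le_def) (simp add: A21_def)

text \<open>The 2 by 2 matrix units. Products with mismatched ends are zero, the additive top, which
  lies below none of them.\<close>

fun B21_edge :: "bool \<Rightarrow> bool \<Rightarrow> B21_elem" where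
  "B21_edge True True = Bcd"
| "B21_edge True False = Bc"
| "B21_edge False True = Bd"
| "B21_edge False False = Bdc"

lemma B21_edge_unit: "B.le B1 (B21_edge a z) \<longleftrightarrow> a = z"
  by (cases a; cases z) (simp_all add: B21_ops)

lemma B21_edge_mul:
  "B.le (mul_op B21 (B21_edge p q) y) (B21_edge a z) \<longleftrightarrow> a = p \<and> B.le y (B21_edge q z)"
  by (cases p; cases q; cases a; cases z; cases y)
    (simp_all add: B21_ops)

lemma rigid_B21: "rigid B21"
  unfolding rigid_def admissible_def
proof (intro allI impI ballI conjI)
  fix p q u assume pq: "satisfies B21 {(p, q)}" and u: "u \<in> words q"
  show "set u \<subseteq> (\<Union>w\<in>words p. set w)"
    by (rule B.content_subset[OF pq u, of B0])
      (simp_all add: B21_ops B21_relations)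
  show "path s t a (filter K u) z" if "\<forall>w\<in>words p. path s t a (filter K w) z"
    for K and s t :: "nat \<Rightarrow> bool" and a z
    by (rule B.identity_walk[OF pq u B21_edge_unit B21_edge_mul]) (use that in blast)
qed

text \<open>The Rees matrix representation of the nonzero nonunits of \<open>A21\<close>: the product of
  \<open>(i, j)\<close> and \<open>(k, l)\<close> is \<open>0\<close> if \<open>j = k = True\<close> and \<open>(i, l)\<close> otherwise.\<close>

fun A21_entry :: "bool \<Rightarrow> bool \<Rightarrow> A21_elem" where
  "A21_entry False False = Aa"
| "A21_entry False True = Aab"
| "A21_entry True False = Aba"
| "A21_entry True True = Ab"

text \<open>With the first index negated, the product of the entries for \<open>(p, q)\<close> and
  \<open>(p', q')\<close> is nonzero iff \<open>q\<close> implies \<open>p'\<close>, so implication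
  replaces equality.\<close>

lemma A21_entry_unit: "A.le A1 (A21_entry (\<not> a) z) \<longleftrightarrow> (a \<longrightarrow> z)"
  by (cases a; cases z) (simp_all add: A21_ops A21_add_def)

lemma A21_entry_mul:
  "A.le (mul_op A21 (A21_entry (\<not> p) q) y) (A21_entry (\<not> a) z) \<longleftrightarrow>
     (a \<longrightarrow> p) \<and> A.le y (A21_entry (\<not> q) z)"
  by (cases p; cases q; cases a; cases z; cases y) (simp_all add: A21_ops A21_add_def)

text \<open>Equality of truth values is implication between them and between their negations, so two
  walk tests in \<open>A21\<close> replace one path test.\<close>

lemma path_iff_walks:
  "path s t a w z \<longleftrightarrow> walk (\<longrightarrow>) s t a w z \<and>
     walk (\<longrightarrow>) (\<lambda>x. \<not> s x) (\<lambda>x. \<not> t x) (\<not> a) w (\<not> z)"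
  by (induction w arbitrary: a) auto

lemma rigid_A21: "rigid A21"
  unfolding rigid_def admissible_def
proof (intro allI impI ballI conjI)
  fix p q u assume pq: "satisfies A21 {(p, q)}" and u: "u \<in> words q"
  show "set u \<subseteq> (\<Union>w\<in>words p. set w)"
    by (rule A.content_subset[OF pq u, of A0])
      (simp_all add: A21_ops A21_relations A21_add_def)
  have *: "walk (\<longrightarrow>) s t a (filter K u) z" if "\<And>w. w \<in> words p \<Longrightarrow> walk (\<longrightarrow>) s t a (filter K w) z"
    for K and s t :: "nat \<Rightarrow> bool" and a z
    by (rule A.identity_walk[OF pq u, where e = "\<lambda>a z. A21_entry (\<not> a) z" and m = "\<lambda>p q. A21_entry (\<not> p) q",
          OF A21_entry_unit A21_entry_mul that])
  show "path s t a (filter K u) z" if "\<forall>w\<in>words p. path s t a (filter K w) z"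
    for K and s t :: "nat \<Rightarrow> bool" and a z
    using that unfolding path_iff_walks by (intro conjI *) blast+
qed

theorem corollary2p25:
  assumes "infinite (UNIV :: 'u set)"
  shows "inherently_nonfinitely_based_algebra TYPE('u) B21 \<and>
         inherently_nonfinitely_based_algebra TYPE('u) A21"
proof
  have "UNIV = {B0, B1, Bc, Bd, Bcd, Bdc}" using B21_elem.exhaust by blast
  then have "finite (UNIV :: B21_elem set)" by (metis finite.simps)
  then show "inherently_nonfinitely_based_algebra TYPE('u) B21"
    using ai_semiring_B21 rigid_B21 assms
    by (intro inherently_nonfinitely_based_if_rigid) (simp_all add: ai_semiring_def)
next
  have "UNIV = {A0, A1, Aa, Ab, Aab, Aba}" using A21_elem.exhaust by blast
  then have "finite (UNIV :: A21_elem set)" by (metis finite.simps)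
  then show "inherently_nonfinitely_based_algebra TYPE('u) A21"
    using ai_semiring_A21 rigid_A21 assms
    by (intro inherently_nonfinitely_based_if_rigid) (simp_all add: ai_semiring_def)
qed

end
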